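(* Assume $\mu>\mu_{c_1}(D_1,D_2)$. Then system $( * )$ is uniformly persistent with respect to solutions with $N(0)>0$, $P(0)>0$, $Z(0)>0$: there exists $\varepsilon>0$ such that every such solution satisfies $\liminf_{t\to\infty}N(t)\ge\varepsilon$, $\liminf_{t\to\infty}P(t)\ge\varepsilon$ and $\liminf_{t\to\infty}Z(t)\ge\varepsilon$.
   Context: Standing setup. Let $D>0$, $D_1>0$, $D_2>0$, $\gamma_1>0$, $\gamma_2>0$ be constants and $\mu>0$ a parameter. Let $f_1,f_2:[0,\infty)\to[0,\infty)$ be continuously differentiable and bounded, with $f_i(0)=0$, $f_i'(x)>0$ for all $x\ge 0$, $\lim_{N\to\infty}f_1(N)>\max(D,D_1)/\gamma_1$ and $\lim_{P\to\infty}f_2(P)>\max(D,D_2)/\gamma_2$. The system $( * )$ is $$\frac{dN}{dt}=(\mu-N)D-Pf_1(N),\quad \frac{dP}{dt}=\gamma_1Pf_1(N)-D_1P-Zf_2(P),\quad \frac{dZ}{dt}=\gamma_2Zf_2(P)-D_2Z.$$ $\lambda_P(d)$ is the unique number with $f_1(\lambda_P(d))=d/\gamma_1$, $\lambda_Z(d)$ the unique number with $f_2(\lambda_Z(d))=d/\gamma_2$, and $\mu_{c_1}(D_1,D_2)=\lambda_P(D_1)+D_1\lambda_Z(D_2)/(D\gamma_1)$. *)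

theory Defs
  imports "HOL-Analysis.Analysis"
begin

text \<open>Standing hypotheses on a response function f with parameters d, gamma
  (d plays the role of max(D, D_i)).\<close>
definition response_fun :: "(real \<Rightarrow> real) \<Rightarrow> real \<Rightarrow> real \<Rightarrow> bool" where
  "response_fun f d \<gamma> \<longleftrightarrow>
     (\<forall>x\<ge>0. f x \<ge> 0) \<and>
     (\<exists>B. \<forall>x\<ge>0. f x \<le> B) \<and>
     f 0 = 0 \<and>
     (\<exists>f'. continuous_on {0..} f' \<and>
        (\<forall>x\<ge>0. (f has_real_derivative f' x) (at x within {0..}) \<and> f' x > 0)) \<and>
     (\<exists>L. (f \<longlongrightarrow> L) at_top \<and> L > d / \<gamma>)"

definition lam :: "(real \<Rightarrow> real) \<Rightarrow> real \<Rightarrow> real \<Rightarrow> real" where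
  "lam f \<gamma> d = (THE x. x \<ge> 0 \<and> f x = d / \<gamma>)"

definition mu_c1 :: "(real \<Rightarrow> real) \<Rightarrow> (real \<Rightarrow> real) \<Rightarrow> real \<Rightarrow> real \<Rightarrow> real \<Rightarrow> real \<Rightarrow> real \<Rightarrow> real" where
  "mu_c1 f1 f2 D \<gamma>1 \<gamma>2 D1 D2 = lam f1 \<gamma>1 D1 + D1 * lam f2 \<gamma>2 D2 / (D * \<gamma>1)"

definition is_solution ::
  "(real \<Rightarrow> real) \<Rightarrow> (real \<Rightarrow> real) \<Rightarrow> real \<Rightarrow> real \<Rightarrow> real \<Rightarrow> real \<Rightarrow> real \<Rightarrow> real
   \<Rightarrow> (real \<Rightarrow> real) \<Rightarrow> (real \<Rightarrow> real) \<Rightarrow> (real \<Rightarrow> real) \<Rightarrow> bool" where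
  "is_solution f1 f2 \<mu> D D1 D2 \<gamma>1 \<gamma>2 N P Z \<longleftrightarrow>
     (\<forall>t\<ge>0.
        (N has_real_derivative ((\<mu> - N t) * D - P t * f1 (N t))) (at t within {0..}) \<and>
        (P has_real_derivative (\<gamma>1 * P t * f1 (N t) - D1 * P t - Z t * f2 (P t))) (at t within {0..}) \<and>
        (Z has_real_derivative (\<gamma>2 * Z t * f2 (P t) - D2 * Z t)) (at t within {0..}))"

end

theory Submission
  imports Defs
begin

text \<open>
  The threshold condition says that the \<open>Z\<close>-free equilibrium \<open>(l, p, 0)\<close> satisfies
  \<open>f2 p > D2 / \<gamma>2\<close>, so that \<open>Z\<close> can invade it.  In the plane \<open>Z = 0\<close> this equilibrium has
  Hsu's Lyapunov function \<open>V = G N + P - p ln P\<close> with \<open>G' = (\<gamma>1 f1 - D1) / f1\<close>, whose derivative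
  is negative except on the line \<open>N = l\<close>.  On that line \<open>(N - l) (p - P)\<close> has derivative
  \<open>f1 l (p - P)\<^sup>2\<close>.  Hence, for suitable positive constants,
  \<open>W = ln Z + C (N - l) (p - P) - K V - A Z\<close>
  grows at a uniform positive rate as long as \<open>Z\<close> is small; the term \<open>- A Z\<close> yields the same when
  \<open>P\<close> is small, since then \<open>Z\<close> decays.  On the absorbing set a very negative \<open>W\<close> forces \<open>Z\<close> or \<open>P\<close>
  to be small, so \<open>W\<close> is eventually bounded below.  As \<open>W\<close> is \<open>ln Z + K p ln P\<close> up to a bounded
  term, this bounds \<open>P\<close> and \<open>Z\<close> away from zero.
\<close>

lemma continuous_on_Icc_of_deriv_Ici:
  fixes y y' :: "real \<Rightarrow> real"
  assumes "0 \<le> a"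
    and "\<And>t. t \<in> {a..b} \<Longrightarrow> (y has_real_derivative y' t) (at t within {0..})"
  shows "continuous_on {a..b} y"
proof (rule DERIV_continuous_on)
  show "(y has_real_derivative y' t) (at t within {a..b})" if "t \<in> {a..b}" for t
    using DERIV_subset[OF assms(2)[OF that], of "{a..b}"] \<open>0 \<le> a\<close> by auto
qed

lemma increment_ge_of_deriv_ge:
  fixes y y' :: "real \<Rightarrow> real"
  assumes "0 \<le> a" "a \<le> b"
    and der: "\<And>t. t \<in> {a..b} \<Longrightarrow> (y has_real_derivative y' t) (at t within {0..})"
    and ge: "\<And>t. t \<in> {a<..<b} \<Longrightarrow> \<delta> \<le> y' t"
  shows "y a + \<delta> * (b - a) \<le> y b"
proof -
  have "y a - \<delta> * a \<le> y b - \<delta> * b"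
  proof (rule DERIV_nonneg_imp_increasing_open[OF \<open>a \<le> b\<close>])
    fix x assume x: "a < x" "x < b"
    hence "at x within {0..} = at x"
      using \<open>0 \<le> a\<close> by (intro at_within_interior) (auto simp: interior_real_atLeast)
    hence "(y has_real_derivative y' x) (at x)"
      using der[of x] x by auto
    hence "((\<lambda>t. y t - \<delta> * t) has_real_derivative y' x - \<delta>) (at x)"
      by (auto intro!: derivative_eq_intros)
    thus "\<exists>d. ((\<lambda>t. y t - \<delta> * t) has_real_derivative d) (at x) \<and> 0 \<le> d"
      using ge[of x] x by (intro exI[of _ "y' x - \<delta>"]) auto
  next
    have "continuous_on {a..b} y"
      using der assms(1) by (intro continuous_on_Icc_of_deriv_Ici[where y' = y']) auto
    thus "continuous_on {a..b} (\<lambda>t. y t - \<delta> * t)"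
      by (intro continuous_intros)
  qed
  thus ?thesis by (simp add: algebra_simps)
qed

lemma eventually_ge_of_deriv_ge_below:
  fixes y y' :: "real \<Rightarrow> real"
  assumes "0 \<le> T" "0 < \<delta>"
    and der: "\<And>t. T \<le> t \<Longrightarrow> (y has_real_derivative y' t) (at t within {0..})"
    and ge: "\<And>t. T \<le> t \<Longrightarrow> y t < w \<Longrightarrow> \<delta> \<le> y' t"
  shows "\<forall>\<^sub>F t in at_top. w \<le> y t"
proof -
  have "\<exists>t1\<ge>T. w \<le> y t1"
  proof (rule ccontr)
    assume "\<not> ?thesis"
    hence low: "\<And>t. T \<le> t \<Longrightarrow> y t < w" by force
    define b where "b = T + (w - y T) / \<delta>"
    have "T \<le> b" using low[of T] \<open>0 < \<delta>\<close> by (simp add: b_def)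
    have "y T + \<delta> * (b - T) \<le> y b"
      by (rule increment_ge_of_deriv_ge[OF \<open>0 \<le> T\<close> \<open>T \<le> b\<close>, where y' = y']) (use der ge low in auto)
    moreover have "\<delta> * (b - T) = w - y T" using \<open>0 < \<delta>\<close> by (simp add: b_def)
    ultimately show False using low[OF \<open>T \<le> b\<close>] by simp
  qed
  then obtain t1 where t1: "T \<le> t1" "w \<le> y t1" by blast
  have "w \<le> y t" if "t1 \<le> t" for t
  proof (rule ccontr)
    assume "\<not> w \<le> y t"
    have cont: "continuous_on {t1..t} y"
      using der assms(1) t1 by (intro continuous_on_Icc_of_deriv_Ici[where y' = y']) auto
    define S where "S = {s \<in> {t1..t}. w \<le> y s}"
    have "closedin (top_of_set {t1..t}) S"
      unfolding S_def using continuous_closedin_preimage[OF cont closed_atLeast[of w]]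
      by (simp add: vimage_def Int_def)
    hence "compact S" by (rule closedin_compact[OF compact_Icc])
    moreover have "S \<noteq> {}" using t1 that by (auto simp: S_def)
    ultimately obtain s where s: "s \<in> S" "\<And>r. r \<in> S \<Longrightarrow> r \<le> s"
      by (meson compact_attains_sup)
    have "y s + \<delta> * (t - s) \<le> y t"
    proof (rule increment_ge_of_deriv_ge[where y' = y'])
      show "\<delta> \<le> y' r" if "r \<in> {s<..<t}" for r
      proof (rule ge)
        have "r \<notin> S" using s(2)[of r] that by auto
        thus "y r < w" using that s(1) by (auto simp: S_def)
      qed (use that s(1) t1 in \<open>auto simp: S_def\<close>)
    qed (use s t1 der \<open>0 \<le> T\<close> in \<open>auto simp: S_def\<close>)
    moreover have "w \<le> y s" "0 \<le> \<delta> * (t - s)" using s \<open>0 < \<delta>\<close> by (auto simp: S_def)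
    ultimately show False using \<open>\<not> w \<le> y t\<close> by simp
  qed
  thus ?thesis using eventually_at_top_linorder by blast
qed

lemma compact_pos_add_multiple:
  fixes \<phi> q :: "'a::t2_space \<Rightarrow> real"
  assumes "compact X" "continuous_on X \<phi>" "continuous_on X q"
    and q: "\<And>x. x \<in> X \<Longrightarrow> 0 \<le> q x"
    and \<phi>: "\<And>x. x \<in> X \<Longrightarrow> q x = 0 \<Longrightarrow> 0 < \<phi> x"
  shows "\<exists>K>0. \<exists>\<delta>>0. \<forall>x\<in>X. \<delta> \<le> \<phi> x + K * q x"
proof (cases "X = {}")
  case False
  have "\<exists>K>0. \<forall>x\<in>X. 0 < \<phi> x + K * q x"
  proof -
    define Y where "Y = {x \<in> X. \<phi> x \<le> 0}"
    have "closedin (top_of_set X) Y"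
      unfolding Y_def using continuous_closedin_preimage[OF assms(2) closed_atMost[of 0]]
      by (simp add: vimage_def Int_def)
    hence Y: "compact Y" "Y \<subseteq> X" using assms(1) closedin_compact by (auto simp: Y_def)
    show ?thesis
    proof (cases "Y = {}")
      case True
      thus ?thesis using q by (intro exI[of _ 1]) (force simp: Y_def)
    next
      case nonempty: False
      obtain a where a: "a \<in> Y" "\<And>x. x \<in> Y \<Longrightarrow> q a \<le> q x"
        using continuous_attains_inf[OF Y(1) nonempty] assms(3) Y(2) continuous_on_subset by metis
      obtain b where b: "b \<in> Y" "\<And>x. x \<in> Y \<Longrightarrow> \<phi> b \<le> \<phi> x"
        using continuous_attains_inf[OF Y(1) nonempty] assms(2) Y(2) continuous_on_subset by metis
      have qa: "0 < q a" using a(1) q[of a] \<phi>[of a] by (force simp: Y_def)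
      define K where "K = (1 - \<phi> b) / q a"
      have "\<phi> b \<le> 0" using b by (auto simp: Y_def)
      hence K: "0 < K" using qa by (simp add: K_def)
      have "0 < \<phi> x + K * q x" if "x \<in> X" for x
      proof (cases "x \<in> Y")
        case True
        have "1 - \<phi> b = K * q a" using qa by (simp add: K_def)
        also have "\<dots> \<le> K * q x" using K a True by (simp add: mult_left_mono)
        finally show ?thesis using b True by force
      next
        case False
        thus ?thesis using that q[of x] K by (auto simp: Y_def add_pos_nonneg)
      qed
      thus ?thesis using K by blast
    qed
  qed
  then obtain K where K: "0 < K" "\<And>x. x \<in> X \<Longrightarrow> 0 < \<phi> x + K * q x" by blast
  have cont: "continuous_on X (\<lambda>x. \<phi> x + K * q x)" using assms by (intro continuous_intros)
  obtain a where "a \<in> X" "\<And>x. x \<in> X \<Longrightarrow> \<phi> a + K * q a \<le> \<phi> x + K * q x"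
    using continuous_attains_inf[OF assms(1) False cont] by blast
  thus ?thesis using K by (intro exI[of _ K] conjI exI[of _ "\<phi> a + K * q a"]) auto
qed (auto intro: exI[of _ 1])

lemma pos_of_deriv_ge_linear:
  fixes y y' :: "real \<Rightarrow> real"
  assumes "0 \<le> b"
    and der: "\<And>t. t \<in> {0..b} \<Longrightarrow> (y has_real_derivative y' t) (at t within {0..})"
    and ge: "\<And>t. t \<in> {0<..<b} \<Longrightarrow> - c * y t \<le> y' t"
    and "0 < y 0"
  shows "0 < y b"
proof -
  have "y 0 * exp (c * 0) + 0 * (b - 0) \<le> y b * exp (c * b)"
  proof (rule increment_ge_of_deriv_ge[where y' = "\<lambda>t. (y' t + c * y t) * exp (c * t)"])
    show "((\<lambda>t. y t * exp (c * t)) has_real_derivative (y' t + c * y t) * exp (c * t)) (at t within {0..})"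
      if "t \<in> {0..b}" for t
      using der[OF that] by (auto intro!: derivative_eq_intros simp: algebra_simps)
    show "0 \<le> (y' t + c * y t) * exp (c * t)" if "t \<in> {0<..<b}" for t
      using ge[OF that] by simp
  qed (use assms in auto)
  hence "0 < y b * exp (c * b)" using \<open>0 < y 0\<close> by simp
  thus ?thesis by (simp add: zero_less_mult_iff)
qed

lemma response_funD:
  assumes "response_fun f d \<gamma>"
  shows "continuous_on {0..} f" "f 0 = 0" "\<And>x. 0 \<le> x \<Longrightarrow> 0 \<le> f x"
    and "\<exists>B>0. \<forall>x\<ge>0. f x \<le> B"
    and "\<And>x y. 0 \<le> x \<Longrightarrow> x < y \<Longrightarrow> f x < f y"
    and "\<exists>L>0. \<forall>x\<ge>0. f x \<le> L * x"
proof -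
  obtain f' where f': "continuous_on {0..} f'"
    "\<And>x. 0 \<le> x \<Longrightarrow> (f has_real_derivative f' x) (at x within {0..})" "\<And>x. 0 \<le> x \<Longrightarrow> 0 < f' x"
    using assms unfolding response_fun_def by blast
  show cont: "continuous_on {0..} f"
    using f'(2) by (auto simp: continuous_on_eq_continuous_within intro!: DERIV_continuous)
  show f0: "f 0 = 0" and "\<And>x. 0 \<le> x \<Longrightarrow> 0 \<le> f x"
    using assms by (auto simp: response_fun_def)
  obtain B0 where "\<forall>x\<ge>0. f x \<le> B0" using assms by (auto simp: response_fun_def)
  hence B: "0 < max B0 1" "\<forall>x\<ge>0. f x \<le> max B0 1" by auto
  thus "\<exists>B>0. \<forall>x\<ge>0. f x \<le> B" by blast
  have der: "(f has_real_derivative f' x) (at x)" if "0 < x" for x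
  proof -
    have "at x within {0..} = at x"
      using that by (intro at_within_interior) (auto simp: interior_real_atLeast)
    thus ?thesis using f'(2)[of x] that by simp
  qed
  show "f x < f y" if "0 \<le> x" "x < y" for x y
  proof (rule DERIV_pos_imp_increasing_open[OF that(2)])
    show "\<exists>d. (f has_real_derivative d) (at z) \<and> 0 < d" if "x < z" "z < y" for z
      using der[of z] f'(3)[of z] that \<open>0 \<le> x\<close> by force
    show "continuous_on {x..y} f" using cont that by (auto intro: continuous_on_subset)
  qed
  have "compact (f' ` {0..1})"
    using f'(1) by (intro compact_continuous_image) (auto intro: continuous_on_subset)
  then obtain L where L: "\<And>x. x \<in> {0..1} \<Longrightarrow> f' x \<le> L"
    by (force dest!: compact_imp_bounded simp: bounded_iff abs_le_iff)
  have "f x \<le> max L (max B0 1) * x" if "0 \<le> x" for x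
  proof (cases "x \<le> 1")
    case True
    have "- f 0 + - L * (x - 0) \<le> - f x"
      by (rule increment_ge_of_deriv_ge[where y' = "\<lambda>t. - f' t"])
        (use that True f'(2) L in \<open>auto intro!: derivative_eq_intros\<close>)
    hence "f x \<le> L * x" using f0 by simp
    also have "\<dots> \<le> max L (max B0 1) * x" using that by (intro mult_right_mono) auto
    finally show ?thesis .
  next
    case False
    have "f x \<le> max B0 1 * 1" using B that by simp
    also have "\<dots> \<le> max L (max B0 1) * x" using False by (intro mult_mono) auto
    finally show ?thesis .
  qed
  thus "\<exists>L>0. \<forall>x\<ge>0. f x \<le> L * x" by (intro exI[of _ "max L (max B0 1)"]) auto
qed

lemma lam_spec:
  assumes "response_fun f d \<gamma>" "0 < \<gamma>" "0 < e" "e \<le> d"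
  shows "0 < lam f \<gamma> e" "f (lam f \<gamma> e) = e / \<gamma>"
proof -
  note r = response_funD[OF assms(1)]
  obtain L where L: "(f \<longlongrightarrow> L) at_top" "d / \<gamma> < L"
    using assms by (auto simp: response_fun_def)
  have eL: "e / \<gamma> < L" using L(2) assms by (smt (verit) divide_right_mono)
  have "\<forall>\<^sub>F x in at_top. e / \<gamma> < f x \<and> 0 \<le> x"
    using order_tendstoD(1)[OF L(1) eL] eventually_ge_at_top[of 0] by eventually_elim auto
  then obtain b where b: "e / \<gamma> < f b" "0 \<le> b"
    by (metis (mono_tags, lifting) eventually_at_top_linorder order_refl)
  have "\<exists>x\<ge>0. x \<le> b \<and> f x = e / \<gamma>"
    by (rule IVT') (use b r assms in \<open>auto intro: continuous_on_subset\<close>)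
  then obtain x where x: "0 \<le> x" "f x = e / \<gamma>" by blast
  have "lam f \<gamma> e = x"
    unfolding lam_def using x r(5) by (intro the_equality) (auto, metis linorder_neqE less_irrefl)
  moreover have "x \<noteq> 0" using x r(2) assms by auto
  ultimately show "0 < lam f \<gamma> e" "f (lam f \<gamma> e) = e / \<gamma>" using x by auto
qed

lemma first_zero:
  fixes y :: "real \<Rightarrow> real"
  assumes cont: "continuous_on {0..} y" and "0 < y 0" "0 \<le> t" "y t \<le> 0"
  obtains b where "0 < b" "y b = 0" "\<And>s. 0 \<le> s \<Longrightarrow> s < b \<Longrightarrow> 0 < y s"
proof -
  have cont': "continuous_on {0..b} y" for b using cont by (rule continuous_on_subset) auto
  define S where "S = {s \<in> {0..t}. y s \<le> 0}"
  have "closedin (top_of_set {0..t}) S"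
    unfolding S_def using continuous_closedin_preimage[OF cont' closed_atMost[of 0]]
    by (simp add: vimage_def Int_def)
  hence "compact S" by (rule closedin_compact[OF compact_Icc])
  moreover have "S \<noteq> {}" using assms by (auto simp: S_def)
  ultimately obtain b where b: "b \<in> S" "\<And>s. s \<in> S \<Longrightarrow> b \<le> s"
    by (meson compact_attains_inf)
  have before: "0 < y s" if "0 \<le> s" "s < b" for s
    using b(1) b(2)[of s] that by (force simp: S_def)
  obtain s where s: "0 \<le> s" "s \<le> b" "y s = 0"
    using IVT2'[OF _ _ _ cont', of b 0] b(1) \<open>0 < y 0\<close> by (auto simp: S_def)
  hence "s = b" using before[of s] by force
  show thesis
  proof (rule that)
    show "0 < b" using s \<open>s = b\<close> \<open>0 < y 0\<close> by (cases "b = 0") auto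
  qed (use b s \<open>s = b\<close> before in \<open>auto simp: S_def\<close>)
qed

locale food_chain =
  fixes f1 f2 :: "real \<Rightarrow> real" and D D1 D2 \<gamma>1 \<gamma>2 \<mu> :: real
  assumes pos: "0 < D" "0 < D1" "0 < D2" "0 < \<gamma>1" "0 < \<gamma>2" "0 < \<mu>"
    and resp1: "response_fun f1 (max D D1) \<gamma>1"
    and resp2: "response_fun f2 (max D D2) \<gamma>2"
begin

definition positive_solution :: "(real \<Rightarrow> real) \<Rightarrow> (real \<Rightarrow> real) \<Rightarrow> (real \<Rightarrow> real) \<Rightarrow> bool" where
  "positive_solution N P Z \<longleftrightarrow>
     is_solution f1 f2 \<mu> D D1 D2 \<gamma>1 \<gamma>2 N P Z \<and> 0 < N 0 \<and> 0 < P 0 \<and> 0 < Z 0"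

lemma positive_solution_deriv:
  assumes "positive_solution N P Z" "0 \<le> t"
  shows "(N has_real_derivative (\<mu> - N t) * D - P t * f1 (N t)) (at t within {0..})"
    and "(P has_real_derivative \<gamma>1 * P t * f1 (N t) - D1 * P t - Z t * f2 (P t)) (at t within {0..})"
    and "(Z has_real_derivative \<gamma>2 * Z t * f2 (P t) - D2 * Z t) (at t within {0..})"
  using assms by (auto simp: positive_solution_def is_solution_def)

lemma positive_solution_pos:
  assumes sol: "positive_solution N P Z" and "0 \<le> t"
  shows "0 < N t" "0 < P t" "0 < Z t"
proof -
  note der = positive_solution_deriv[OF sol]
  have cont: "continuous_on {0..} N" "continuous_on {0..} P" "continuous_on {0..} Z"
    using der by (auto intro!: DERIV_continuous_on)
  have init: "0 < N 0" "0 < P 0" "0 < Z 0" using sol by (auto simp: positive_solution_def)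
  have Npos: "0 < N s" if "0 \<le> s" for s
  proof (rule ccontr)
    assume "\<not> 0 < N s"
    hence "N s \<le> 0" by simp
    from first_zero[OF cont(1) init(1) \<open>0 \<le> s\<close> this]
    obtain b where b: "0 < b" "N b = 0" "\<And>s. 0 \<le> s \<Longrightarrow> s < b \<Longrightarrow> 0 < N s" by blast
    have "f1 0 = 0" by (rule response_funD(2)[OF resp1])
    hence "(N has_real_derivative \<mu> * D) (at b within {0..})" using der(1)[of b] b by simp
    from has_real_derivative_pos_inc_left[OF this] pos obtain d
      where d: "0 < d" "\<And>h. 0 < h \<Longrightarrow> b - h \<in> {0..} \<Longrightarrow> h < d \<Longrightarrow> N (b - h) < N b" by auto
    define h where "h = min (d / 2) (b / 2)"
    have "0 < h" "h < d" "h < b" using d b by (auto simp: h_def)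
    thus False using d(2)[of h] b(2) b(3)[of "b - h"] by auto
  qed
  have PZpos: "0 < min (P s) (Z s)" if "0 \<le> s" for s
  proof (rule ccontr)
    assume "\<not> 0 < min (P s) (Z s)"
    hence low: "min (P s) (Z s) \<le> 0" by linarith
    have "continuous_on {0..} (\<lambda>s. min (P s) (Z s))" using cont by (intro continuous_intros)
    from first_zero[OF this _ \<open>0 \<le> s\<close> low] init
    obtain b where b: "0 < b" "min (P b) (Z b) = 0"
      "\<And>s. 0 \<le> s \<Longrightarrow> s < b \<Longrightarrow> 0 < min (P s) (Z s)" by (metis min_less_iff_conj)
    have PZ: "0 < P s" "0 < Z s" if "0 \<le> s" "s < b" for s using b(3)[OF that] by auto
    have "0 < Z b"
    proof (rule pos_of_deriv_ge_linear[where c = D2 and y = Z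
          and y' = "\<lambda>t. \<gamma>2 * Z t * f2 (P t) - D2 * Z t"])
      show "- D2 * Z t \<le> \<gamma>2 * Z t * f2 (P t) - D2 * Z t" if "t \<in> {0<..<b}" for t
        using PZ[of t] that pos response_funD(3)[OF resp2, of "P t"] by simp
    qed (use der b init in auto)
    moreover have "0 < P b"
    proof -
      obtain L where L: "0 < L" "\<And>x. 0 \<le> x \<Longrightarrow> f2 x \<le> L * x"
        using response_funD(6)[OF resp2] by blast
      have "compact (Z ` {0..b})"
        using cont(3) by (intro compact_continuous_image) (auto intro: continuous_on_subset)
      then obtain M where M: "\<And>t. t \<in> {0..b} \<Longrightarrow> Z t \<le> M"
        by (force dest!: compact_imp_bounded simp: bounded_iff abs_le_iff)
      show ?thesis
      proof (rule pos_of_deriv_ge_linear[where c = "D1 + M * L" and y = P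
            and y' = "\<lambda>t. \<gamma>1 * P t * f1 (N t) - D1 * P t - Z t * f2 (P t)"])
        fix t assume t: "t \<in> {0<..<b}"
        have "Z t * f2 (P t) \<le> M * (L * P t)"
          using t L PZ[of t] M[of t] response_funD(3)[OF resp2, of "P t"] by (intro mult_mono) auto
        moreover have "0 \<le> \<gamma>1 * P t * f1 (N t)"
          using t pos PZ[of t] response_funD(3)[OF resp1, of "N t"] Npos[of t] by simp
        ultimately show "- (D1 + M * L) * P t \<le> \<gamma>1 * P t * f1 (N t) - D1 * P t - Z t * f2 (P t)"
          by (simp add: algebra_simps)
      qed (use der b init in auto)
    qed
    ultimately show False using b by auto
  qed
  show "0 < N t" "0 < P t" "0 < Z t" using Npos PZpos \<open>0 \<le> t\<close> by auto
qed

lemma ultimately_bounded: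
  "\<exists>M>0. \<forall>N P Z. positive_solution N P Z \<longrightarrow> (\<forall>\<^sub>F t in at_top. N t \<le> M \<and> P t \<le> M \<and> Z t \<le> M)"
proof -
  define m where "m = min D (min D1 D2)"
  have m: "0 < m" "m \<le> D" "m \<le> D1" "m \<le> D2" using pos by (auto simp: m_def)
  define S where "S = \<gamma>1 * \<gamma>2 * D * \<mu> / m + 1"
  have S: "m * S = \<gamma>1 * \<gamma>2 * D * \<mu> + m" "0 < S"
    using m pos by (auto simp: S_def field_simps add_pos_pos)
  define M where "M = S / (\<gamma>1 * \<gamma>2) + S / \<gamma>2 + S"
  have M: "0 < M" "S / (\<gamma>1 * \<gamma>2) \<le> M" "S / \<gamma>2 \<le> M" "S \<le> M"
    using pos S by (auto simp: M_def add_pos_pos)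
  have "\<forall>\<^sub>F t in at_top. N t \<le> M \<and> P t \<le> M \<and> Z t \<le> M" if sol: "positive_solution N P Z" for N P Z
  proof -
    note der = positive_solution_deriv[OF sol]
    have "\<forall>\<^sub>F t in at_top. - S \<le> - (\<gamma>1 * \<gamma>2 * N t + \<gamma>2 * P t + Z t)"
    proof (rule eventually_ge_of_deriv_ge_below[where T = 0 and \<delta> = m
          and y' = "\<lambda>t. - (\<gamma>1 * \<gamma>2 * D * (\<mu> - N t) - \<gamma>2 * D1 * P t - D2 * Z t)"])
      fix t :: real assume t: "0 \<le> t"
      show "((\<lambda>t. - (\<gamma>1 * \<gamma>2 * N t + \<gamma>2 * P t + Z t)) has_real_derivative
          - (\<gamma>1 * \<gamma>2 * D * (\<mu> - N t) - \<gamma>2 * D1 * P t - D2 * Z t)) (at t within {0..})"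
        by (rule derivative_eq_intros der[OF t] refl | simp add: algebra_simps)+
      assume "- (\<gamma>1 * \<gamma>2 * N t + \<gamma>2 * P t + Z t) < - S"
      hence "m * S \<le> m * (\<gamma>1 * \<gamma>2 * N t + \<gamma>2 * P t + Z t)" using m by simp
      moreover have "m * (\<gamma>1 * \<gamma>2 * N t) \<le> D * (\<gamma>1 * \<gamma>2 * N t)" "m * (\<gamma>2 * P t) \<le> D1 * (\<gamma>2 * P t)"
        "m * Z t \<le> D2 * Z t"
        using m pos positive_solution_pos[OF sol t] by (auto intro!: mult_right_mono)
      ultimately show "m \<le> - (\<gamma>1 * \<gamma>2 * D * (\<mu> - N t) - \<gamma>2 * D1 * P t - D2 * Z t)"
        using S by (simp add: algebra_simps)
    qed (use m in auto)
    thus ?thesis using eventually_ge_at_top[of 0]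
    proof eventually_elim
      case (elim t)
      have "0 < \<gamma>1 * \<gamma>2 * N t" "0 < \<gamma>2 * P t" "0 < Z t"
        using positive_solution_pos[OF sol] elim pos by auto
      hence "\<gamma>1 * \<gamma>2 * N t \<le> S" "\<gamma>2 * P t \<le> S" "Z t \<le> S" using elim by linarith+
      hence "N t \<le> S / (\<gamma>1 * \<gamma>2)" "P t \<le> S / \<gamma>2" "Z t \<le> S"
        using pos by (auto simp: field_simps)
      thus ?case using M by linarith
    qed
  qed
  thus ?thesis using M by blast
qed

lemma nutrient_persistent:
  assumes M: "0 < M"
  shows "\<exists>n>0. \<forall>N P Z. positive_solution N P Z \<and> (\<forall>\<^sub>F t in at_top. P t \<le> M) \<longrightarrow>
    (\<forall>\<^sub>F t in at_top. n \<le> N t)"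
proof -
  obtain L where L: "0 < L" "\<And>x. 0 \<le> x \<Longrightarrow> f1 x \<le> L * x"
    using response_funD(6)[OF resp1] by blast
  define n where "n = \<mu> * D / 2 / (D + M * L)"
  have c: "0 < D + M * L" using pos L M by (simp add: add_pos_pos)
  have n: "0 < n" using c pos by (simp add: n_def)
  have cn: "(D + M * L) * n = \<mu> * D / 2"
    using nonzero_mult_div_cancel_left[of "D + M * L" "\<mu> * D / 2"] c
    unfolding n_def by (metis less_irrefl times_divide_eq_right)
  have "\<forall>\<^sub>F t in at_top. n \<le> N t"
    if sol: "positive_solution N P Z" and ev: "\<forall>\<^sub>F t in at_top. P t \<le> M" for N P Z
  proof -
    obtain T0 where "\<And>t. T0 \<le> t \<Longrightarrow> P t \<le> M" using ev eventually_at_top_linorder by metis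
    hence T: "\<And>t. max 0 T0 \<le> t \<Longrightarrow> P t \<le> M" by simp
    show ?thesis
    proof (rule eventually_ge_of_deriv_ge_below[where T = "max 0 T0" and \<delta> = "\<mu> * D / 2"])
      fix t assume t: "max 0 T0 \<le> t"
      show "(N has_real_derivative (\<mu> - N t) * D - P t * f1 (N t)) (at t within {0..})"
        using positive_solution_deriv[OF sol] t by simp
      have p: "0 < N t" "0 < P t" using positive_solution_pos[OF sol, of t] t by auto
      assume "N t < n"
      hence "(D + M * L) * N t \<le> \<mu> * D / 2" using c unfolding cn[symmetric] by simp
      moreover have "P t * f1 (N t) \<le> M * (L * N t)"
        using p T[OF t] M L response_funD(3)[OF resp1, of "N t"] by (intro mult_mono) auto
      ultimately show "\<mu> * D / 2 \<le> (\<mu> - N t) * D - P t * f1 (N t)"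
        by (simp add: algebra_simps)
    qed (use pos in auto)
  qed
  thus ?thesis using n by blast
qed

definition weight where "weight x = (\<gamma>1 * f1 x - D1) / f1 x"

text \<open>\<open>dissipation p\<close> is \<open>- V'\<close> along the flow in the plane \<open>Z = 0\<close>; it depends on \<open>N\<close> only.\<close>

definition dissipation where
  "dissipation p x = (\<gamma>1 * f1 x - D1) * (p * f1 x - (\<mu> - x) * D) / f1 x"

lemma lyapunov_deriv_eq:
  fixes N P Z F1 F2 :: real
  assumes "0 < F1" "0 < P"
  shows "(\<gamma>2 * F2 - D2)
      + C * (((\<mu> - N) * D - P * F1) * (p - P) - (N - l) * (\<gamma>1 * P * F1 - D1 * P - Z * F2))
      - K * ((\<gamma>1 * F1 - D1) / F1 * ((\<mu> - N) * D - P * F1)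
             + (\<gamma>1 * P * F1 - D1 * P - Z * F2) - p * ((\<gamma>1 * P * F1 - D1 * P - Z * F2) / P))
      - A * (\<gamma>2 * Z * F2 - D2 * Z)
    = (\<gamma>2 * F2 - D2 + C * ((p - P) * ((\<mu> - N) * D - P * F1) - (N - l) * (\<gamma>1 * P * F1 - D1 * P)))
      + K * ((\<gamma>1 * F1 - D1) * (p * F1 - (\<mu> - N) * D) / F1)
      + Z * (C * (N - l) * F2 + K * (F2 - p * (F2 / P)) - A * (\<gamma>2 * F2 - D2))"
  using assms by (simp add: field_simps)

lemma f1_pos: "0 < x \<Longrightarrow> 0 < f1 x"
  using response_funD(2,5)[OF resp1] by (metis order_refl)

lemma continuous_weight:
  assumes "0 < a"
  shows "continuous_on {a..b} weight" "continuous_on {a..b} (dissipation p)"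
proof -
  have "continuous_on {a..b} f1"
    using response_funD(1)[OF resp1] assms by (auto intro: continuous_on_subset)
  moreover have "f1 x \<noteq> 0" if "x \<in> {a..b}" for x using f1_pos[of x] assms that by auto
  ultimately show "continuous_on {a..b} weight" "continuous_on {a..b} (dissipation p)"
    unfolding weight_def[abs_def] dissipation_def[abs_def] by (auto intro!: continuous_intros)
qed

lemma weight_antiderivative:
  assumes "0 < a"
  obtains G where "\<And>x. x \<in> {a..b} \<Longrightarrow> (G has_real_derivative weight x) (at x)"
proof -
  obtain G where G: "\<And>x. x \<in> {a / 2..b + 1} \<Longrightarrow>
      (G has_vector_derivative weight x) (at x within {a / 2..b + 1})"
    using antiderivative_continuous[OF continuous_weight(1)[of "a / 2" "b + 1"]] assms by auto
  show thesis
  proof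
    fix x assume x: "x \<in> {a..b}"
    hence "at x within {a / 2..b + 1} = at x"
      using assms by (intro at_within_interior) (auto simp: interior_atLeastAtMost_real)
    thus "(G has_real_derivative weight x) (at x)"
      using G[of x] x assms by (auto simp: has_real_derivative_iff_has_vector_derivative)
  qed
qed

lemma dissipation_nonneg:
  assumes l: "0 < l" "f1 l = D1 / \<gamma>1" and p: "0 \<le> p" "p * D1 = (\<mu> - l) * D * \<gamma>1" and "0 < x"
  shows "0 \<le> dissipation p x" "dissipation p x = 0 \<Longrightarrow> x = l"
proof -
  have "p * f1 l = (\<mu> - l) * D" unfolding l(2) using p(2) pos by (simp add: field_simps)
  hence eq: "p * f1 x - (\<mu> - x) * D = p * (f1 x - f1 l) + D * (x - l)"
    by (simp add: algebra_simps)
  have D1: "D1 = \<gamma>1 * f1 l" using l(2) pos by simp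
  have d: "dissipation p x = \<gamma>1 * ((f1 x - f1 l) * (p * (f1 x - f1 l) + D * (x - l))) / f1 x"
    unfolding dissipation_def eq by (simp add: D1 algebra_simps)
  have "0 < (f1 x - f1 l) * (p * (f1 x - f1 l) + D * (x - l))" if "x \<noteq> l"
  proof (cases "x < l")
    case True
    hence "f1 x < f1 l" using response_funD(5)[OF resp1] \<open>0 < x\<close> by simp
    moreover have "p * (f1 x - f1 l) \<le> 0" "D * (x - l) < 0"
      using calculation True p(1) pos by (auto simp: mult_nonneg_nonpos mult_pos_neg)
    ultimately show ?thesis by (intro mult_neg_neg) linarith+
  next
    case False
    hence "l < x" using that by simp
    moreover from this have "f1 l < f1 x" using response_funD(5)[OF resp1] l(1) by simp
    ultimately show ?thesis using p(1) pos by (intro mult_pos_pos add_nonneg_pos) auto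
  qed
  hence "0 < dissipation p x" if "x \<noteq> l"
    unfolding d using that f1_pos[OF \<open>0 < x\<close>] pos by simp
  moreover have "dissipation p l = 0" unfolding dissipation_def using D1 by simp
  ultimately show "0 \<le> dissipation p x" "dissipation p x = 0 \<Longrightarrow> x = l"
    by (cases "x = l"; force)+
qed

lemma transversal_growth:
  assumes thr: "mu_c1 f1 f2 D \<gamma>1 \<gamma>2 D1 D2 < \<mu>" and "0 < a"
  obtains l p C K \<delta> where "0 < l" "0 < p" "0 < C" "0 < K" "0 < \<delta>"
    "\<And>N P. N \<in> {a..M} \<Longrightarrow> P \<in> {0..M} \<Longrightarrow>
      \<delta> \<le> (\<gamma>2 * f2 P - D2
           + C * ((p - P) * ((\<mu> - N) * D - P * f1 N) - (N - l) * (\<gamma>1 * P * f1 N - D1 * P)))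
         + K * dissipation p N"
proof -
  define l where "l = lam f1 \<gamma>1 D1"
  define z where "z = lam f2 \<gamma>2 D2"
  define p where "p = (\<mu> - l) * D * \<gamma>1 / D1"
  have l: "0 < l" "f1 l = D1 / \<gamma>1" and z: "0 < z" "f2 z = D2 / \<gamma>2"
    unfolding l_def z_def using lam_spec[OF resp1] lam_spec[OF resp2] pos by auto
  have pD1: "p * D1 = (\<mu> - l) * D * \<gamma>1" using pos by (simp add: p_def)
  have "D1 * z / (D * \<gamma>1) < \<mu> - l" using thr by (simp add: mu_c1_def l_def z_def)
  hence zp: "z < p" using pos by (simp add: p_def field_simps)
  hence p: "0 < p" using z by simp
  define C where "C = (D2 + 1) / (f1 l * (p - z)\<^sup>2)"
  have sq: "0 < f1 l * (p - z)\<^sup>2" using f1_pos[OF l(1)] zp by simp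
  have C: "0 < C" "C * (f1 l * (p - z)\<^sup>2) = D2 + 1"
    using sq pos by (auto simp: C_def add_pos_pos)
  define \<phi> where "\<phi> = (\<lambda>(N, P). \<gamma>2 * f2 P - D2
     + C * ((p - P) * ((\<mu> - N) * D - P * f1 N) - (N - l) * (\<gamma>1 * P * f1 N - D1 * P)))"
  have on_nullcline: "0 < \<phi> (l, P)" if "0 \<le> P" for P
  proof -
    have "(\<mu> - l) * D = p * f1 l" unfolding l(2) using pD1 pos by (simp add: field_simps)
    hence eq: "\<phi> (l, P) = \<gamma>2 * f2 P - D2 + C * (f1 l * (p - P)\<^sup>2)"
      by (simp add: \<phi>_def power2_eq_square algebra_simps)
    have sqP: "0 \<le> C * (f1 l * (p - P)\<^sup>2)" using C f1_pos[OF l(1)] by simp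
    show ?thesis
    proof (cases "z < P")
      case True
      hence "D2 / \<gamma>2 < f2 P" using response_funD(5)[OF resp2, of z P] z by simp
      hence "D2 < \<gamma>2 * f2 P" using pos by (simp add: field_simps)
      thus ?thesis using eq sqP by linarith
    next
      case False
      hence "(p - z)\<^sup>2 \<le> (p - P)\<^sup>2" using zp by (intro power_mono) auto
      hence "C * (f1 l * (p - z)\<^sup>2) \<le> C * (f1 l * (p - P)\<^sup>2)"
        using C(1) f1_pos[OF l(1)] by (intro mult_left_mono) auto
      moreover have "0 \<le> \<gamma>2 * f2 P" using response_funD(3)[OF resp2 that] pos by simp
      ultimately show ?thesis using eq C(2) by linarith
    qed
  qed
  have "\<exists>K>0. \<exists>\<delta>>0. \<forall>x\<in>{a..M} \<times> {0..M}. \<delta> \<le> \<phi> x + K * dissipation p (fst x)"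
  proof (rule compact_pos_add_multiple)
    show "compact ({a..M} \<times> {0..M})" by (intro compact_Times compact_Icc)
    have "continuous_on ({a..M} \<times> {0..M}) (\<lambda>x. f1 (fst x))"
      using \<open>0 < a\<close> by (intro continuous_on_compose2[OF response_funD(1)[OF resp1]] continuous_intros) auto
    moreover have "continuous_on ({a..M} \<times> {0..M}) (\<lambda>x. f2 (snd x))"
      by (intro continuous_on_compose2[OF response_funD(1)[OF resp2]] continuous_intros) auto
    ultimately show "continuous_on ({a..M} \<times> {0..M}) \<phi>"
      unfolding \<phi>_def case_prod_unfold by (intro continuous_intros)
    show "continuous_on ({a..M} \<times> {0..M}) (\<lambda>x. dissipation p (fst x))"
      by (intro continuous_on_compose2[OF continuous_weight(2)[OF \<open>0 < a\<close>, of M]] continuous_intros) auto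
  next
    fix x :: "real \<times> real" assume x: "x \<in> {a..M} \<times> {0..M}"
    hence "0 < fst x" using \<open>0 < a\<close> by auto
    note diss = dissipation_nonneg[OF l _ pD1 this]
    show "0 \<le> dissipation p (fst x)" using diss p by simp
    assume "dissipation p (fst x) = 0"
    hence "fst x = l" using diss p by simp
    thus "0 < \<phi> x" using on_nullcline[of "snd x"] x by (cases x) auto
  qed
  then obtain K \<delta> where K: "0 < K" "0 < \<delta>"
    "\<And>x. x \<in> {a..M} \<times> {0..M} \<Longrightarrow> \<delta> \<le> \<phi> x + K * dissipation p (fst x)" by blast
  show thesis
  proof (rule that[OF l(1) p C(1) K(1,2)])
    fix N P assume "N \<in> {a..M}" "P \<in> {0..M}"
    thus "\<delta> \<le> (\<gamma>2 * f2 P - D2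
           + C * ((p - P) * ((\<mu> - N) * D - P * f1 N) - (N - l) * (\<gamma>1 * P * f1 N - D1 * P)))
         + K * dissipation p N"
      using K(3)[of "(N, P)"] by (simp add: \<phi>_def)
  qed
qed

theorem uniformly_persistent:
  assumes thr: "mu_c1 f1 f2 D \<gamma>1 \<gamma>2 D1 D2 < \<mu>"
  shows "\<exists>\<epsilon>>0. \<forall>N P Z. positive_solution N P Z \<longrightarrow>
    (\<forall>\<^sub>F t in at_top. \<epsilon> \<le> N t \<and> \<epsilon> \<le> P t \<and> \<epsilon> \<le> Z t)"
proof -
  obtain M where M: "0 < M" "\<And>N P Z. positive_solution N P Z \<Longrightarrow>
      \<forall>\<^sub>F t in at_top. N t \<le> M \<and> P t \<le> M \<and> Z t \<le> M"
    using ultimately_bounded by blast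
  obtain a where a: "0 < a" "\<And>N P Z. positive_solution N P Z \<Longrightarrow>
      \<forall>\<^sub>F t in at_top. P t \<le> M \<Longrightarrow> \<forall>\<^sub>F t in at_top. a \<le> N t"
    using nutrient_persistent[OF M(1)] by blast
  obtain l p C K \<delta> where lp: "0 < l" "0 < p" "0 < C" "0 < K" "0 < \<delta>"
    and growth: "\<And>N P. N \<in> {a..M} \<Longrightarrow> P \<in> {0..M} \<Longrightarrow>
      \<delta> \<le> (\<gamma>2 * f2 P - D2
           + C * ((p - P) * ((\<mu> - N) * D - P * f1 N) - (N - l) * (\<gamma>1 * P * f1 N - D1 * P)))
         + K * dissipation p N"
    using transversal_growth[OF thr a(1), where M = M] by metis
  obtain G where G: "\<And>x. x \<in> {a..M} \<Longrightarrow> (G has_real_derivative weight x) (at x)"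
    using weight_antiderivative[OF a(1), where b = M] by metis
  have "continuous_on {a..M} G"
    using G by (intro DERIV_continuous_on) (auto intro: has_field_derivative_at_within)
  hence "compact (G ` {a..M})" by (intro compact_continuous_image) auto
  then obtain g where g: "\<And>x. x \<in> {a..M} \<Longrightarrow> \<bar>G x\<bar> \<le> g"
    by (force dest!: compact_imp_bounded simp: bounded_iff)
  obtain B where B: "0 < B" "\<And>x. 0 \<le> x \<Longrightarrow> f2 x \<le> B"
    using response_funD(4)[OF resp2] by blast
  obtain L where L: "0 < L" "\<And>x. 0 \<le> x \<Longrightarrow> f2 x \<le> L * x"
    using response_funD(6)[OF resp2] by blast
  define c where "c = C * l * B + K * p * L"
  define A where "A = 2 * c / D2"
  define b where "b = D2 / (2 * \<gamma>2 * L)"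
  define \<eta> where "\<eta> = \<delta> / (2 * A * \<gamma>2 * B)"
  have c: "0 < c" using lp B L by (simp add: c_def add_pos_pos)
  have A: "0 < A" "A * D2 = 2 * c" using c pos by (auto simp: A_def)
  have b: "0 < b" "\<gamma>2 * (L * b) = D2 / 2" using pos L by (auto simp: b_def)
  have \<eta>: "0 < \<eta>" "A * \<gamma>2 * B * \<eta> = \<delta> / 2" using lp A pos B by (auto simp: \<eta>_def)
  define W where "W N P Z = ln Z + C * ((N - l) * (p - P)) - K * (G N + P - p * ln P) - A * Z"
    for N P Z :: real
  define R where "R = C * ((M + l) * (p + M))"
  define w where "w = ln \<eta> - R - K * (g + M - p * ln b) - A * M"
  define w1 where "w1 = w - R - K * g"
  define \<epsilon> where "\<epsilon> = min a (min (exp ((w1 - ln M) / (K * p))) (exp (w1 - K * p * ln M)))"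
  have cross: "\<bar>C * ((N - l) * (p - P))\<bar> \<le> R" if "N \<in> {a..M}" "P \<in> {0..M}" for N P
  proof -
    have "\<bar>N - l\<bar> * \<bar>p - P\<bar> \<le> (M + l) * (p + M)"
      using that a lp M by (intro mult_mono) auto
    thus ?thesis using lp by (simp add: R_def abs_mult)
  qed
  have ev: "\<forall>\<^sub>F t in at_top. \<epsilon> \<le> N t \<and> \<epsilon> \<le> P t \<and> \<epsilon> \<le> Z t"
    if sol: "positive_solution N P Z" for N P Z
  proof -
    have "\<forall>\<^sub>F t in at_top. P t \<le> M" using M(2)[OF sol] by (rule eventually_mono) simp
    hence "\<forall>\<^sub>F t in at_top. a \<le> N t \<and> N t \<le> M \<and> P t \<le> M \<and> Z t \<le> M"
      using M(2)[OF sol] a(2)[OF sol] by (auto intro: eventually_conj)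
    then obtain T0 where T0: "\<And>t. T0 \<le> t \<Longrightarrow> a \<le> N t \<and> N t \<le> M \<and> P t \<le> M \<and> Z t \<le> M"
      by (auto simp: eventually_at_top_linorder)
    define T where "T = max 0 T0"
    have bd: "N t \<in> {a..M}" "P t \<in> {0..M}" "0 < N t" "0 < P t" "P t \<le> M" "0 < Z t" "Z t \<le> M" "0 \<le> t"
      if "T \<le> t" for t
      using T0[of t] positive_solution_pos[OF sol, of t] that by (auto simp: T_def)
    define W' where "W' t = (\<gamma>2 * f2 (P t) - D2)
      + C * (((\<mu> - N t) * D - P t * f1 (N t)) * (p - P t)
          - (N t - l) * (\<gamma>1 * P t * f1 (N t) - D1 * P t - Z t * f2 (P t)))
      - K * ((\<gamma>1 * f1 (N t) - D1) / f1 (N t) * ((\<mu> - N t) * D - P t * f1 (N t))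
             + (\<gamma>1 * P t * f1 (N t) - D1 * P t - Z t * f2 (P t))
             - p * ((\<gamma>1 * P t * f1 (N t) - D1 * P t - Z t * f2 (P t)) / P t))
      - A * (\<gamma>2 * Z t * f2 (P t) - D2 * Z t)" for t
    have "\<forall>\<^sub>F t in at_top. w \<le> W (N t) (P t) (Z t)"
    proof (rule eventually_ge_of_deriv_ge_below[where T = T and y' = W' and \<delta> = "\<delta> / 2"])
      fix t assume t: "T \<le> t"
      note bd = bd[OF t]
      note der = positive_solution_deriv[OF sol \<open>0 \<le> t\<close>]
      have derG: "((\<lambda>t. G (N t)) has_real_derivative
          weight (N t) * ((\<mu> - N t) * D - P t * f1 (N t))) (at t within {0..})"
        by (rule DERIV_chain2[OF G[OF bd(1)] der(1)])
      show "((\<lambda>t. W (N t) (P t) (Z t)) has_real_derivative W' t) (at t within {0..})"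
        unfolding W_def W'_def using bd
        by (auto intro!: derivative_eq_intros der derG simp: weight_def field_simps)
      define F where "F = f2 (P t)"
      have F: "0 \<le> F" "F \<le> B" "F \<le> L * P t"
        unfolding F_def using response_funD(3)[OF resp2, of "P t"] B L bd by auto
      define E where "E = C * (N t - l) * F + K * (F - p * (F / P t)) - A * (\<gamma>2 * F - D2)"
      have W': "W' t = (\<gamma>2 * F - D2 + C * ((p - P t) * ((\<mu> - N t) * D - P t * f1 (N t))
            - (N t - l) * (\<gamma>1 * P t * f1 (N t) - D1 * P t)))
          + K * dissipation p (N t) + Z t * E"
        unfolding W'_def dissipation_def E_def F_def
        by (rule lyapunov_deriv_eq) (use f1_pos bd in auto)
      have ge: "\<delta> + Z t * E \<le> W' t"
        using growth[OF bd(1,2)] unfolding W' F_def by simp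
      have "C * (l * F) \<le> C * (l * B)" "0 \<le> C * (N t * F)"
        using lp F bd by (auto intro!: mult_left_mono)
      hence "- (C * l * B) \<le> C * (N t - l) * F" by (simp add: algebra_simps)
      moreover have "- (K * p * L) \<le> K * (F - p * (F / P t))"
      proof -
        have "F / P t \<le> L" using F bd by (simp add: field_simps)
        hence "K * (p * (F / P t)) \<le> K * (p * L)" using lp by (intro mult_left_mono) auto
        moreover have "0 \<le> K * F" using lp F by simp
        ultimately show ?thesis by (simp add: algebra_simps)
      qed
      ultimately have E: "c - A * \<gamma>2 * F \<le> E"
        using A(2) by (simp add: E_def c_def algebra_simps)
      assume low: "W (N t) (P t) (Z t) < w"
      show "\<delta> / 2 \<le> W' t"
      proof (cases "P t \<le> b")
        case True
        have "\<gamma>2 * F \<le> \<gamma>2 * (L * P t)" using F pos by simp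
        also have "\<dots> \<le> \<gamma>2 * (L * b)" using True L pos by simp
        finally have "A * (\<gamma>2 * F) \<le> A * (D2 / 2)"
          unfolding b(2) using A(1) by (intro mult_left_mono) auto
        hence "0 \<le> E" using E A(2) by (simp add: algebra_simps)
        hence "0 \<le> Z t * E" using bd by simp
        thus ?thesis using ge lp by linarith
      next
        case False
        have "Z t < \<eta>"
        proof (rule ccontr)
          assume "\<not> Z t < \<eta>"
          hence "ln \<eta> \<le> ln (Z t)" using \<eta> bd by simp
          moreover have "- R \<le> C * ((N t - l) * (p - P t))" using cross[OF bd(1,2)] by linarith
          moreover have "ln b \<le> ln (P t)" using False b bd by simp
          hence "p * ln b \<le> p * ln (P t)" using lp by simp
          hence "G (N t) + P t - p * ln (P t) \<le> g + M - p * ln b"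
            using g[OF bd(1)] bd(5) by linarith
          hence "K * (G (N t) + P t - p * ln (P t)) \<le> K * (g + M - p * ln b)" using lp by simp
          moreover have "A * Z t \<le> A * M" using A bd by simp
          ultimately have "w \<le> W (N t) (P t) (Z t)" unfolding w_def W_def by linarith
          thus False using low by simp
        qed
        have "A * \<gamma>2 * F \<le> A * \<gamma>2 * B" using A pos F by simp
        hence "- (A * \<gamma>2 * B) \<le> E" using E c by linarith
        hence "Z t * - (A * \<gamma>2 * B) \<le> Z t * E" using bd by (intro mult_left_mono) auto
        moreover have "A * \<gamma>2 * B * Z t \<le> A * \<gamma>2 * B * \<eta>" using \<open>Z t < \<eta>\<close> A pos B by simp
        ultimately show ?thesis using ge \<eta>(2) by (simp add: algebra_simps)
      qed
    qed (use lp in \<open>auto simp: T_def\<close>)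
    thus ?thesis using eventually_ge_at_top[of T]
    proof eventually_elim
      case (elim t)
      note bd = bd[OF elim(2)]
      have "- (K * g) \<le> K * G (N t)" using g[OF bd(1)] lp
        by (metis abs_le_iff minus_le_iff mult_left_mono mult_minus_right less_imp_le)
      moreover have "0 \<le> K * P t" "0 \<le> A * Z t" using lp A bd by auto
      moreover have "C * ((N t - l) * (p - P t)) \<le> R" using cross[OF bd(1,2)] by linarith
      ultimately have sum: "w1 \<le> ln (Z t) + K * p * ln (P t)"
        using elim(1) by (simp add: w1_def W_def algebra_simps)
      have lnM: "ln (Z t) \<le> ln M" "ln (P t) \<le> ln M" using bd M by auto
      have "K * p * ln (P t) \<le> K * p * ln M" using lnM lp by simp
      hence "w1 - K * p * ln M \<le> ln (Z t)" using sum by linarith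
      hence "exp (w1 - K * p * ln M) \<le> Z t" using bd by (simp add: ln_ge_iff)
      moreover have "(w1 - ln M) / (K * p) \<le> ln (P t)"
        using sum lnM lp by (simp add: pos_divide_le_eq algebra_simps)
      hence "exp ((w1 - ln M) / (K * p)) \<le> P t" using bd by (simp add: ln_ge_iff)
      ultimately show ?case using bd(1) by (auto simp: \<epsilon>_def min_le_iff_disj)
    qed
  qed
  show ?thesis
  proof (intro exI conjI allI impI)
    show "0 < \<epsilon>" using a by (simp add: \<epsilon>_def)
  qed (rule ev)
qed

end

theorem theorem2p6:
  fixes f1 f2 :: "real \<Rightarrow> real" and D D1 D2 \<gamma>1 \<gamma>2 \<mu> :: real
  assumes "D > 0" "D1 > 0" "D2 > 0" "\<gamma>1 > 0" "\<gamma>2 > 0" "\<mu> > 0"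
    and "response_fun f1 (max D D1) \<gamma>1"
    and "response_fun f2 (max D D2) \<gamma>2"
    and "\<mu> > mu_c1 f1 f2 D \<gamma>1 \<gamma>2 D1 D2"
  shows "\<exists>\<epsilon>>0. \<forall>N P Z. is_solution f1 f2 \<mu> D D1 D2 \<gamma>1 \<gamma>2 N P Z \<and> N 0 > 0 \<and> P 0 > 0 \<and> Z 0 > 0 \<longrightarrow>
           Liminf at_top (\<lambda>t. ereal (N t)) \<ge> ereal \<epsilon> \<and>
           Liminf at_top (\<lambda>t. ereal (P t)) \<ge> ereal \<epsilon> \<and>
           Liminf at_top (\<lambda>t. ereal (Z t)) \<ge> ereal \<epsilon>"
proof -
  interpret food_chain f1 f2 D D1 D2 \<gamma>1 \<gamma>2 \<mu>
    using assms by unfold_locales auto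
  obtain \<epsilon> where \<epsilon>: "0 < \<epsilon>" "\<And>N P Z. positive_solution N P Z \<Longrightarrow>
      \<forall>\<^sub>F t in at_top. \<epsilon> \<le> N t \<and> \<epsilon> \<le> P t \<and> \<epsilon> \<le> Z t"
    using uniformly_persistent assms(9) by blast
  show ?thesis
  proof (intro exI[of _ \<epsilon>] conjI allI impI \<epsilon>(1); elim conjE)
    fix N P Z
    assume "is_solution f1 f2 \<mu> D D1 D2 \<gamma>1 \<gamma>2 N P Z" "0 < N 0" "0 < P 0" "0 < Z 0"
    hence "\<forall>\<^sub>F t in at_top. \<epsilon> \<le> N t \<and> \<epsilon> \<le> P t \<and> \<epsilon> \<le> Z t"
      by (intro \<epsilon>(2)) (simp add: positive_solution_def)
    thus "ereal \<epsilon> \<le> Liminf at_top (\<lambda>t. ereal (N t))"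
      "ereal \<epsilon> \<le> Liminf at_top (\<lambda>t. ereal (P t))"
      "ereal \<epsilon> \<le> Liminf at_top (\<lambda>t. ereal (Z t))"
      by (auto intro!: Liminf_bounded elim: eventually_mono)
  qed
qed

end
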